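(* Let $n \geq 2$ be an integer and let $F$ be a field with $\operatorname{char}(F)=2$ and $\operatorname{rank}_2(F)=n$. Then there exist $2^n$ anisotropic bilinear $n$-fold Pfister forms over $F$ with no common slot, i.e. for which there is no $\beta\in F^\times$ such that $\langle\langle \beta\rangle\rangle_b$ is a factor of every one of these forms.
   Context: For a field $F$ of characteristic 2, the 2-rank is $\operatorname{rank}_2(F)=\log_2([F:F^2])$, where $F^2=\{x^2 : x\in F\}$. For $\beta_1,\dots,\beta_k\in F^\times$, $\langle \beta_1,\dots,\beta_k\rangle_b$ denotes the diagonal symmetric bilinear form $B(v,w)=\sum_{i=1}^k \beta_i v_i w_i$ on $F^k$. A bilinear 1-fold Pfister form is $\langle\langle \beta\rangle\rangle_b=\langle 1,\beta\rangle_b$ with $\beta\in F^\times$; a bilinear $n$-fold Pfister form is a form (isometric to) $\langle\langle \beta_1,\dots,\beta_n\rangle\rangle_b=\langle\langle \beta_1\rangle\rangle_b\otimes\cdots\otimes\langle\langle \beta_n\rangle\rangle_b$ with $\beta_i\in F^\times$. A symmetric bilinear form $B$ is anisotropic if $B(v,v)\neq 0$ for all $v\neq 0$. A bilinear $m$-fold Pfister form $\rho$ ($m \le n$) is a factor of a bilinear $n$-fold Pfister form $B$ if $B\simeq \rho\otimes\pi$ for some bilinear $(n-m)$-fold Pfister form $\pi$ (the $0$-fold Pfister form being $\langle 1\rangle_b$). A common slot of several bilinear Pfister forms is an element $\beta\in F^\times$ such that $\langle\langle\beta\rangle\rangle_b$ is a factor of each of them. *)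

theory Defs
  imports
    "Jordan_Normal_Form.Matrix"
    "HOL-Algebra.Algebraic_Closure_Type"
    "HOL-Library.Extended_Real"
    Complex_Main
begin

text \<open>
  The squares form a subfield of a field only in characteristic 2, so the 2-rank is meaningful
  only there. The library's dimension function is unspecified in the infinite-dimensional
  case, hence the case distinction.
\<close>

definition squares :: "'a :: field set" where
  "squares = {x ^ 2 | x. True}"

definition rank2 :: "'a :: field itself \<Rightarrow> ereal" where
  "rank2 _ =
     (let R = (ring_of_type_algebra :: 'a ring) in
        if ring.finite_dimension R squares UNIV
        then ereal (log 2 (real (ring.dim R squares UNIV)))
        else \<infinity>)"

text \<open>
  A symmetric bilinear form on $F^k$ is represented by its Gram matrix, a symmetric
  $k \times k$ matrix.
\<close>

definition is_form :: "'a :: field mat \<Rightarrow> bool" where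
  "is_form M \<longleftrightarrow> square_mat M \<and> transpose_mat M = M"

definition bform :: "'a :: field mat \<Rightarrow> 'a vec \<Rightarrow> 'a vec \<Rightarrow> 'a" where
  "bform M v w = v \<bullet> (M *\<^sub>v w)"

definition anisotropic :: "'a :: field mat \<Rightarrow> bool" where
  "anisotropic M \<longleftrightarrow>
     (\<forall>v \<in> carrier_vec (dim_row M). v \<noteq> 0\<^sub>v (dim_row M) \<longrightarrow> bform M v v \<noteq> 0)"

text \<open>The linear bijections of $F^k$ are the maps $v \mapsto P v$ with $P$ invertible.\<close>

definition isometric :: "'a :: field mat \<Rightarrow> 'a mat \<Rightarrow> bool" (infix \<open>\<simeq>\<^sub>b\<close> 50) where
  "M \<simeq>\<^sub>b N \<longleftrightarrow>
     is_form M \<and> is_form N \<and> dim_row M = dim_row N \<and>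
     (\<exists>P \<in> carrier_mat (dim_row M) (dim_row M). invertible_mat P \<and>
        (\<forall>v \<in> carrier_vec (dim_row M). \<forall>w \<in> carrier_vec (dim_row M).
           bform N (P *\<^sub>v v) (P *\<^sub>v w) = bform M v w))"

definition diag_form :: "'a :: field list \<Rightarrow> 'a mat" where
  "diag_form bs = mat_diag (length bs) (\<lambda>i. bs ! i)"

text \<open>
  The space $F^k \otimes F^l$ is identified with $F^{kl}$ by sending $e_i \otimes e_j$ to
  $e_{il+j}$ (indices starting at 0); in this basis the Gram matrix of a tensor product is the
  Kronecker product. See \<open>bform_tensor_form\<close> below for the usual
  description on pure tensors.
\<close>

definition tensor_vec :: "'a :: field vec \<Rightarrow> 'a vec \<Rightarrow> 'a vec" where
  "tensor_vec v w =
     vec (dim_vec v * dim_vec w) (\<lambda>i. v $ (i div dim_vec w) * w $ (i mod dim_vec w))"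

definition tensor_form :: "'a :: field mat \<Rightarrow> 'a mat \<Rightarrow> 'a mat" (infixl \<open>\<otimes>\<^sub>b\<close> 70) where
  "M \<otimes>\<^sub>b N =
     mat (dim_row M * dim_row N) (dim_col M * dim_col N)
       (\<lambda>(i, j). M $$ (i div dim_row N, j div dim_col N) * N $$ (i mod dim_row N, j mod dim_col N))"

fun pfister_diag :: "'a :: field list \<Rightarrow> 'a mat" where
  "pfister_diag [] = diag_form [1]"
| "pfister_diag (b # bs) = diag_form [1, b] \<otimes>\<^sub>b pfister_diag bs"

definition is_pfister :: "nat \<Rightarrow> 'a :: field mat \<Rightarrow> bool" where
  "is_pfister n B \<longleftrightarrow>
     (\<exists>bs. length bs = n \<and> 0 \<notin> set bs \<and> B \<simeq>\<^sub>b pfister_diag bs)"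

definition pfister_factor :: "nat \<Rightarrow> 'a :: field mat \<Rightarrow> nat \<Rightarrow> 'a mat \<Rightarrow> bool" where
  "pfister_factor m \<rho> n B \<longleftrightarrow>
     m \<le> n \<and> is_pfister m \<rho> \<and> is_pfister n B \<and>
     (\<exists>\<pi>. is_pfister (n - m) \<pi> \<and> B \<simeq>\<^sub>b \<rho> \<otimes>\<^sub>b \<pi>)"

definition common_slot :: "'a :: field \<Rightarrow> nat \<Rightarrow> 'a mat set \<Rightarrow> bool" where
  "common_slot \<beta> n S \<longleftrightarrow> \<beta> \<noteq> 0 \<and> (\<forall>B \<in> S. pfister_factor 1 (pfister_diag [\<beta>]) n B)"

lemma bform_diag_form:
  assumes "v \<in> carrier_vec (length bs)" "w \<in> carrier_vec (length bs)"
  shows "bform (diag_form bs) v w = (\<Sum>i<length bs. bs ! i * v $ i * w $ i)"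
proof -
  have "(\<Sum>j<length bs. (if i = j then bs ! j else 0) * w $ j) = bs ! i * w $ i"
    if "i < length bs" for i
    using that by (simp add: if_distrib[of "\<lambda>x. x * _"] cong: if_cong)
  with assms show ?thesis
    by (auto simp: bform_def diag_form_def mat_diag_def scalar_prod_def mult_mat_vec_def
        lessThan_atLeast0 mult_ac intro!: sum.cong)
qed

lemma pfister_diag_single: "pfister_diag [b] = diag_form [1, b]"
  by (rule eq_matI) (auto simp: tensor_form_def diag_form_def mat_diag_def)

lemma sum_div_mod:
  fixes f g :: "nat \<Rightarrow> 'a :: comm_semiring_0"
  shows "(\<Sum>i<k * l. f (i div l) * g (i mod l)) = (\<Sum>i<k. f i) * (\<Sum>j<l. g j)"
proof (cases "l = 0")
  case False
  have "(\<Sum>i<k * l. f (i div l) * g (i mod l)) =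
        (\<Sum>(i, j)\<in>{..<k} \<times> {..<l}. f i * g j)"
  proof (rule sum.reindex_bij_witness[where i = "\<lambda>(i, j). i * l + j" and j = "\<lambda>i. (i div l, i mod l)"])
    fix x assume "x \<in> {..<k} \<times> {..<l}"
    then obtain i j where x: "x = (i, j)" "i < k" "j < l" by auto
    have "i * l + j < Suc i * l" using x by simp
    also have "\<dots> \<le> k * l" using x by (intro mult_right_mono) auto
    finally show "(case x of (i, j) \<Rightarrow> i * l + j) \<in> {..<k * l}" using x by simp
  qed (use False in \<open>auto simp: less_mult_imp_div_less\<close>)
  also have "\<dots> = (\<Sum>i<k. f i) * (\<Sum>j<l. g j)"
    by (simp add: sum_product sum.cartesian_product)
  finally show ?thesis .
qed simp

lemma bform_tensor_form:
  assumes M: "M \<in> carrier_mat k k" "v \<in> carrier_vec k" "v' \<in> carrier_vec k"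
      and N: "N \<in> carrier_mat l l" "w \<in> carrier_vec l" "w' \<in> carrier_vec l"
  shows "bform (M \<otimes>\<^sub>b N) (tensor_vec v w) (tensor_vec v' w') = bform M v v' * bform N w w'"
proof -
  have eq: "bform A x y = (\<Sum>i<n. x $ i * (\<Sum>j<n. A $$ (i, j) * y $ j))"
    if "A \<in> carrier_mat n n" "x \<in> carrier_vec n" "y \<in> carrier_vec n" for A n and x y :: "'a vec"
    using that
    by (auto simp: bform_def scalar_prod_def mult_mat_vec_def lessThan_atLeast0 intro!: sum.cong)
  have T: "M \<otimes>\<^sub>b N \<in> carrier_mat (k * l) (k * l)"
    "tensor_vec v w \<in> carrier_vec (k * l)" "tensor_vec v' w' \<in> carrier_vec (k * l)"
    using assms by (auto simp: tensor_form_def tensor_vec_def)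
  have inner: "(\<Sum>j<k * l. (M \<otimes>\<^sub>b N) $$ (i, j) * tensor_vec v' w' $ j) =
      (\<Sum>j<k. M $$ (i div l, j) * v' $ j) * (\<Sum>j<l. N $$ (i mod l, j) * w' $ j)"
    if "i < k * l" for i
    using assms that unfolding sum_div_mod[symmetric]
    by (intro sum.cong) (auto simp: tensor_form_def tensor_vec_def mult_ac)
  have "bform (M \<otimes>\<^sub>b N) (tensor_vec v w) (tensor_vec v' w') =
      (\<Sum>i<k * l. (v $ (i div l) * (\<Sum>j<k. M $$ (i div l, j) * v' $ j)) *
                  (w $ (i mod l) * (\<Sum>j<l. N $$ (i mod l, j) * w' $ j)))"
    unfolding eq[OF T]
  proof (intro sum.cong refl)
    fix i assume "i \<in> {..<k * l}"
    then have i: "i < k * l" by simp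
    then have "tensor_vec v w $ i = v $ (i div l) * w $ (i mod l)"
      using assms by (simp add: tensor_vec_def)
    then show "tensor_vec v w $ i * (\<Sum>j<k * l. (M \<otimes>\<^sub>b N) $$ (i, j) * tensor_vec v' w' $ j) =
        (v $ (i div l) * (\<Sum>j<k. M $$ (i div l, j) * v' $ j)) *
        (w $ (i mod l) * (\<Sum>j<l. N $$ (i mod l, j) * w' $ j))"
      unfolding inner[OF i] by (simp only: mult_ac)
  qed
  also have "\<dots> = bform M v v' * bform N w w'"
    unfolding eq[OF M] eq[OF N] by (rule sum_div_mod)
  finally show ?thesis .
qed

end

theory Submission
  imports Defs
begin

text \<open>
  The hypothesis on the 2-rank gives elements \<open>a\<^sub>1, \<dots>, a\<^sub>n\<close> that are independent over the
  squares: in the tower obtained from \<open>F\<^sup>2\<close> by adjoining them one after the other, every step has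
  degree 2 (\<open>rank2_imp_two_independent\<close>). The \<open>2\<^sup>n\<close> forms of the theorem are
  \<open>\<langle>\<langle>b\<^sub>1, \<dots>, b\<^sub>n\<rangle>\<rangle>\<close> with each \<open>b\<^sub>i\<close> either \<open>a\<^sub>i\<close> or \<open>a\<^sub>i + 1\<close>.

  Let \<open>B = \<langle>\<langle>b\<^sub>1, \<dots>, b\<^sub>n\<rangle>\<rangle>\<close> with independent \<open>b\<^sub>i\<close>. Its diagonal entries are the \<open>2\<^sup>n\<close> products of
  subfamilies of the \<open>b\<^sub>i\<close>, which are linearly independent over \<open>F\<^sup>2\<close>. Squaring is additive in
  characteristic 2, so \<open>v \<mapsto> B(v, v)\<close> is additive, and by independence it is injective. Hence \<open>B\<close> is
  anisotropic, and the first basis vector \<open>e\<^sub>0\<close> is the only vector of value 1. If \<open>\<langle>\<langle>\<beta>\<rangle>\<rangle>\<close> is a factor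
  of \<open>B\<close>, then there are orthogonal vectors of values 1 and \<open>\<beta>\<close>; the first one must be \<open>e\<^sub>0\<close>, so the
  second one has no \<open>e\<^sub>0\<close>-coordinate. Thus \<open>\<beta>\<close> lies in the \<open>F\<^sup>2\<close>-span of the products of nonempty
  subfamilies (\<open>slot_in_pure_span\<close>), which is the kernel of the linear form on
  \<open>F\<^sup>2(b\<^sub>1, \<dots>, b\<^sub>n)\<close> that reads off the coefficient of 1.

  It remains to see that these kernels meet only in 0 (\<open>Inter_pure_span_shifts\<close>). For \<open>n = 1\<close> they
  are the lines spanned by \<open>a\<close> and by \<open>a + 1\<close> over \<open>F\<^sup>2\<close>, which are different. In general the
  linear form belonging to \<open>b\<^sub>1, \<dots>, b\<^sub>n\<close> is the tensor product of those belonging to the single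
  \<open>b\<^sub>i\<close>, and tensor products of bases are bases, so the \<open>2\<^sup>n\<close> linear forms
  span the dual space.
  The proof expresses this as an induction along the tower.
\<close>

section \<open>The squares and their quadratic extensions\<close>

text \<open>
  In characteristic 2 this is the field \<open>F\<^sup>2(b\<^sub>1, \<dots>, b\<^sub>k)\<close>: the square of \<open>b\<close> lies in the
  subfield already constructed, so adjoining \<open>b\<close> needs only the powers 1 and \<open>b\<close>.
\<close>

fun sqspan :: "'a :: field list \<Rightarrow> 'a set" where
  "sqspan [] = squares"
| "sqspan (b # bs) = {x + b * y | x y. x \<in> sqspan bs \<and> y \<in> sqspan bs}"

text \<open>
  The 2-independence that defines 2-bases, in the form that the tower grows at every step.
\<close>

fun two_independent :: "'a :: field list \<Rightarrow> bool" where
  "two_independent [] \<longleftrightarrow> True"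
| "two_independent (b # bs) \<longleftrightarrow> b \<notin> sqspan bs \<and> two_independent bs"

text \<open>
  The \<open>F\<^sup>2\<close>-span of the products of nonempty subfamilies: a product either omits \<open>b\<close>, and is then a
  nonempty product of the others, or is \<open>b\<close> times an arbitrary product of the others.
\<close>

fun pure_span :: "'a :: field list \<Rightarrow> 'a set" where
  "pure_span [] = {0}"
| "pure_span (b # bs) = {x + b * y | x y. x \<in> pure_span bs \<and> y \<in> sqspan bs}"

lemma zero_in_squares: "0 \<in> squares"
  unfolding squares_def by (auto intro: exI[of _ 0])

lemma sqspan_ConsI: "x \<in> sqspan bs \<Longrightarrow> y \<in> sqspan bs \<Longrightarrow> x + b * y \<in> sqspan (b # bs)"
  by auto

lemma square_in_sqspan: "x\<^sup>2 \<in> sqspan bs"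
proof (induction bs arbitrary: x)
  case (Cons b bs)
  have "x\<^sup>2 + b * 0\<^sup>2 \<in> sqspan (b # bs)"
    by (intro sqspan_ConsI Cons.IH)
  then show ?case by simp
qed (auto simp: squares_def)

lemma zero_in_sqspan: "0 \<in> sqspan bs"
  using square_in_sqspan[of 0] by simp

lemma one_in_sqspan: "1 \<in> sqspan bs"
  using square_in_sqspan[of 1] by simp

lemma pure_span_subset: "pure_span bs \<subseteq> sqspan bs"
  by (induction bs) (auto simp: zero_in_squares)

lemma two_independent_nonzero: "two_independent bs \<Longrightarrow> 0 \<notin> set bs"
  by (induction bs) (auto simp: zero_in_sqspan)

context
  assumes char2: "CHAR('a :: field) = 2"
begin

lemma add_self: "(x :: 'a) + x = 0"
proof -
  have "(2 :: 'a) = 0"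
    using of_nat_CHAR[where 'a = 'a] char2 by simp
  then show ?thesis by (metis mult_2 mult_zero_left)
qed

lemma minus_eq_self: "- (x :: 'a) = x"
  using add_self[of x] by (simp add: minus_unique)

lemma diff_eq_add: "(x :: 'a) - y = x + y"
  using minus_eq_self[of y] by (metis diff_conv_add_uminus)

lemma square_add: "((x :: 'a) + y)\<^sup>2 = x\<^sup>2 + y\<^sup>2"
proof -
  have "(x + y)\<^sup>2 = x\<^sup>2 + y\<^sup>2 + (x * y + x * y)"
    by (simp add: power2_eq_square algebra_simps)
  then show ?thesis by (simp only: add_self add_0_right)
qed

lemma sqspan_add: "(x :: 'a) \<in> sqspan bs \<Longrightarrow> y \<in> sqspan bs \<Longrightarrow> x + y \<in> sqspan bs"
proof (induction bs arbitrary: x y)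
  case Nil
  then show ?case by (auto simp: squares_def simp flip: square_add)
next
  case (Cons b bs)
  then obtain u v u' v' where xy: "x = u + b * v" "y = u' + b * v'"
    and in_span: "u \<in> sqspan bs" "v \<in> sqspan bs" "u' \<in> sqspan bs" "v' \<in> sqspan bs"
    by auto
  have "x + y = (u + u') + b * (v + v')"
    by (simp add: xy algebra_simps)
  then show ?case using Cons.IH in_span by auto
qed

lemma sqspan_mult: "(x :: 'a) \<in> sqspan bs \<Longrightarrow> y \<in> sqspan bs \<Longrightarrow> x * y \<in> sqspan bs"
proof (induction bs arbitrary: x y)
  case Nil
  then show ?case by (auto simp: squares_def simp flip: power_mult_distrib)
next
  case (Cons b bs)
  then obtain u v u' v' where xy: "x = u + b * v" "y = u' + b * v'"
    and in_span: "u \<in> sqspan bs" "v \<in> sqspan bs" "u' \<in> sqspan bs" "v' \<in> sqspan bs"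
    by auto
  have "x * y = (u * u' + b\<^sup>2 * (v * v')) + b * (u * v' + v * u')"
    by (simp add: xy algebra_simps power2_eq_square)
  moreover have "u * u' + b\<^sup>2 * (v * v') \<in> sqspan bs" "u * v' + v * u' \<in> sqspan bs"
    by (intro sqspan_add Cons.IH square_in_sqspan in_span)+
  ultimately show ?case by auto
qed

text \<open>
  Since squares of arbitrary elements are available as scalars, \<open>1/x = x (1/x)\<^sup>2\<close> shows that
  closure under products already gives closure under inverses.
\<close>

lemma sqspan_inverse: "(x :: 'a) \<in> sqspan bs \<Longrightarrow> inverse x \<in> sqspan bs"
proof -
  assume "x \<in> sqspan bs"
  then have "x * (inverse x)\<^sup>2 \<in> sqspan bs"
    by (intro sqspan_mult square_in_sqspan)
  moreover have "x * (inverse x)\<^sup>2 = inverse x"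
    by (cases "x = 0") (simp_all add: power2_eq_square)
  ultimately show ?thesis by simp
qed

text \<open>
  Two different representations would give \<open>b\<close> as a quotient of elements of the smaller field.
\<close>

lemma sqspan_Cons_unique:
  assumes b: "b \<notin> sqspan bs"
    and in_span: "x \<in> sqspan bs" "y \<in> sqspan bs" "x' \<in> sqspan bs" "y' \<in> sqspan bs"
    and eq: "x + b * y = x' + b * (y' :: 'a)"
  shows "x = x' \<and> y = y'"
proof -
  have "b * (y - y') = x' - x"
    using eq by (simp add: algebra_simps)
  then have *: "b * (y + y') = x' + x"
    by (simp only: diff_eq_add)
  have "y + y' = 0"
  proof (rule ccontr)
    assume nz: "y + y' \<noteq> 0"
    then have "b = (x' + x) * inverse (y + y')"
      using * by (simp add: field_simps)
    also have "\<dots> \<in> sqspan bs"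
      using in_span by (intro sqspan_mult sqspan_inverse sqspan_add)
    finally show False using b by simp
  qed
  then have "y = y'"
    by (metis diff_eq_add eq_iff_diff_eq_0)
  then show ?thesis using eq by simp
qed

section \<open>Existence of independent elements\<close>

abbreviation ring_of_field :: "'a ring" where
  "ring_of_field \<equiv> ring_of_type_algebra"

lemma ring_of_field_simps:
  "carrier ring_of_field = UNIV" "x \<otimes>\<^bsub>ring_of_field\<^esub> y = x * y" "x \<oplus>\<^bsub>ring_of_field\<^esub> y = x + y"
  "\<one>\<^bsub>ring_of_field\<^esub> = 1" "\<zero>\<^bsub>ring_of_field\<^esub> = 0"
  by (auto simp: ring_of_type_algebra_def)

lemma sqspan_subfield: "subfield (sqspan bs) ring_of_field"
proof -
  interpret F: Ring.field ring_of_field by (rule field_from_type_algebra)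
  have neg: "\<ominus>\<^bsub>ring_of_field\<^esub> x = x" for x
    by (rule F.minus_equality) (auto simp: ring_of_field_simps add_self)
  have inv: "inv\<^bsub>ring_of_field\<^esub> x = inverse x" if "x \<noteq> 0" for x
    by (rule F.comm_inv_char) (use that in \<open>auto simp: ring_of_field_simps\<close>)
  show ?thesis
    by (intro F.subfieldI' F.subringI)
      (auto simp: ring_of_field_simps neg inv one_in_sqspan sqspan_add sqspan_mult sqspan_inverse)
qed

text \<open>
  Multiplicativity of degrees in the tower: each step has basis 1, \<open>b\<close>.
\<close>

lemma dimension_sqspan:
  assumes "two_independent bs"
  shows "ring.dimension ring_of_field (2 ^ length bs) squares (sqspan bs)"
proof -
  interpret F: Ring.field ring_of_field by (rule field_from_type_algebra)
  have K: "subfield squares ring_of_field"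
    using sqspan_subfield[of "[]"] by simp
  from assms show ?thesis
  proof (induction bs)
    case Nil
    show ?case using F.dimension_one[OF K] by simp
  next
    case (Cons b bs)
    note L = sqspan_subfield[of bs]
    have "F.dimension (Suc 1) (sqspan bs) (F.line_extension (sqspan bs) b (sqspan bs))"
      using Cons.prems F.dimension_one[OF L]
      by (intro F.Suc_dim) (auto simp: ring_of_field_simps)
    also have "F.line_extension (sqspan bs) b (sqspan bs) = sqspan (b # bs)"
      unfolding set_eq_iff F.line_extension_mem_iff
      by (auto simp: ring_of_field_simps algebra_simps)
    finally have "F.dimension (2 ^ length bs * Suc 1) squares (sqspan (b # bs))"
      using Cons by (intro F.telescopic_base[OF K L]) auto
    moreover have "2 ^ length bs * Suc 1 = (2 :: nat) ^ length (b # bs)" by simp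
    ultimately show ?case by (simp only:)
  qed
qed

text \<open>
  A shorter independent list generates a field of degree less than \<open>2\<^sup>n\<close>, so it does not exhaust
  the whole field and can be extended.
\<close>

lemma exists_two_independent:
  assumes dim: "ring.dimension ring_of_field (2 ^ n) squares UNIV" and "m \<le> n"
  shows "\<exists>bs :: 'a list. length bs = m \<and> two_independent bs"
  using \<open>m \<le> n\<close>
proof (induction m)
  case (Suc m)
  interpret F: Ring.field ring_of_field by (rule field_from_type_algebra)
  have K: "subfield squares ring_of_field"
    using sqspan_subfield[of "[]"] by simp
  obtain bs :: "'a list" where bs: "length bs = m" "two_independent bs"
    using Suc by auto
  have "sqspan bs \<noteq> UNIV"
  proof
    assume "sqspan bs = UNIV"
    then have "F.dimension (2 ^ m) squares UNIV"
      using dimension_sqspan[OF bs(2)] bs(1) by simp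
    then have "(2 :: nat) ^ m = 2 ^ n"
      using F.dimension_is_inj[OF K] dim by blast
    then show False using Suc.prems by simp
  qed
  then obtain b where "b \<notin> sqspan bs" by auto
  then show ?case using bs by (intro exI[of _ "b # bs"]) auto
qed auto

lemma rank2_imp_two_independent:
  assumes "rank2 TYPE('a) = ereal (real n)" and "n > 0"
  shows "\<exists>bs :: 'a list. length bs = n \<and> two_independent bs"
proof -
  interpret F: Ring.field ring_of_field by (rule field_from_type_algebra)
  have K: "subfield squares ring_of_field"
    using sqspan_subfield[of "[]"] by simp
  define d where "d = F.dim squares UNIV"
  have fin: "F.finite_dimension squares UNIV" and log: "log 2 (real d) = real n"
    using assms(1) by (auto simp: rank2_def Let_def d_def split: if_splits)
  (* Here log 2 0 = 0, so the equation for the logarithm excludes d = 0 because n is positive. *)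
  have "d \<noteq> 0"
  proof
    assume "d = 0"
    then have "log 2 (real d) = 0" by (simp add: log_def)
    then show False using log \<open>n > 0\<close> by simp
  qed
  then have "real d = 2 powr real n"
    using log \<open>d \<noteq> 0\<close> powr_log_cancel[of 2 "real d"] by simp
  then have "real d = real (2 ^ n)"
    by (simp add: powr_realpow)
  then have "d = 2 ^ n"
    by (simp only: of_nat_eq_iff)
  moreover have "F.dimension d squares UNIV"
    using F.finite_dimensionE[OF K fin] by (simp add: d_def over_def)
  ultimately show ?thesis
    using exists_two_independent[of n n] by simp
qed

end

section \<open>Values of a Pfister form\<close>

text \<open>
  The order is that of the diagonal entries of the iterated Kronecker product; in particular the
  empty product comes first.
\<close>

fun pfister_products :: "'a :: field list \<Rightarrow> 'a list" where
  "pfister_products [] = [1]"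
| "pfister_products (b # bs) = pfister_products bs @ map ((*) b) (pfister_products bs)"

lemma length_pfister_products [simp]: "length (pfister_products bs) = 2 ^ length bs"
  by (induction bs) auto

lemma pfister_products_nth_0: "pfister_products bs ! 0 = 1"
  by (induction bs) (auto simp: nth_append)

lemma diag_form_tensor:
  "diag_form [1, b] \<otimes>\<^sub>b diag_form cs = diag_form (cs @ map ((*) b) cs)"
proof (rule eq_matI)
  fix i j
  assume "i < dim_row (diag_form (cs @ map ((*) b) cs))" "j < dim_col (diag_form (cs @ map ((*) b) cs))"
  then have ij: "i < 2 * length cs" "j < 2 * length cs"
    by (auto simp: diag_form_def mat_diag_def)
  then have "length cs > 0" by (cases cs) auto
  have div: "i div length cs < 2" "j div length cs < 2"
    using ij by (auto simp: less_mult_imp_div_less)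
  have mod: "i mod length cs < length cs" "j mod length cs < length cs"
    using \<open>length cs > 0\<close> by auto
  have eq_iff: "i = j \<longleftrightarrow> i div length cs = j div length cs \<and> i mod length cs = j mod length cs"
    by (metis div_mult_mod_eq)
  have entry: "[1, b] ! (i div length cs) * cs ! (i mod length cs) = (cs @ map ((*) b) cs) ! i"
  proof (cases "i < length cs")
    case False
    then have "i div length cs = 1"
      using ij(1) by (intro div_nat_eqI) auto
    moreover from False have "i mod length cs = i - length cs"
      using ij(1) by (simp add: le_mod_geq)
    ultimately show ?thesis using False ij(1) by (auto simp: nth_append)
  qed (auto simp: nth_append)
  show "(diag_form [1, b] \<otimes>\<^sub>b diag_form cs) $$ (i, j) = diag_form (cs @ map ((*) b) cs) $$ (i, j)"
  proof (cases "i = j")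
    case True
    then show ?thesis
      using ij div mod entry by (simp add: tensor_form_def diag_form_def mat_diag_def)
  next
    case False
    then show ?thesis
      using ij div mod eq_iff by (auto simp: tensor_form_def diag_form_def mat_diag_def)
  qed
qed (auto simp: tensor_form_def diag_form_def mat_diag_def)

lemma pfister_diag_eq_diag_form: "pfister_diag bs = diag_form (pfister_products bs)"
  by (induction bs) (simp_all add: diag_form_tensor)

lemma is_form_diag_form: "is_form (diag_form bs)"
  by (auto simp: is_form_def diag_form_def mat_diag_def intro!: eq_matI)

lemma dim_pfister_diag: "dim_row (pfister_diag bs) = 2 ^ length bs" "dim_col (pfister_diag bs) = 2 ^ length bs"
  by (auto simp: pfister_diag_eq_diag_form diag_form_def mat_diag_def)

lemma isometric_refl:
  assumes "is_form M"
  shows "M \<simeq>\<^sub>b M"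
proof -
  let ?I = "1\<^sub>m (dim_row M)"
  have "inverts_mat ?I ?I"
    by (simp add: inverts_mat_def)
  then have "invertible_mat ?I"
    unfolding invertible_mat_def by (metis carrier_matD index_one_mat(2,3) square_mat.elims(3))
  then show ?thesis
    unfolding isometric_def using assms by (intro conjI bexI[of _ ?I]) simp_all
qed

lemma is_pfister_pfister_diag: "0 \<notin> set bs \<Longrightarrow> is_pfister (length bs) (pfister_diag bs)"
  unfolding is_pfister_def
  by (intro exI[of _ bs]) (auto simp: pfister_diag_eq_diag_form is_form_diag_form isometric_refl)

text \<open>
  Needed to count the forms. The diagonal determines the list: its first half is the diagonal for
  the tail, and the second half starts with the head of the list.
\<close>

lemma pfister_diag_inject:
  assumes "pfister_diag bs = pfister_diag cs"
  shows "bs = cs"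
proof -
  have "length bs = length cs"
    using arg_cong[OF assms, of dim_row] by (simp add: dim_pfister_diag)
  moreover have "map (\<lambda>i. pfister_diag bs $$ (i, i)) [0..<2 ^ length bs] = pfister_products bs" for bs :: "'a list"
    by (rule nth_equalityI) (auto simp: pfister_diag_eq_diag_form diag_form_def mat_diag_def)
  from this[of bs] this[of cs] have "pfister_products bs = pfister_products cs"
    using assms calculation by simp
  ultimately show ?thesis
  proof (induction bs cs rule: list_induct2)
    case (Cons b bs c cs)
    then have "pfister_products bs = pfister_products cs"
        "map ((*) b) (pfister_products bs) = map ((*) c) (pfister_products cs)"
      by simp_all
    moreover from this(2) have "map ((*) b) (pfister_products bs) ! 0 = map ((*) c) (pfister_products cs) ! 0"
      by simp
    ultimately show ?case using Cons.IH by (simp add: pfister_products_nth_0)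
  qed simp
qed

definition pfister_value :: "'a :: field list \<Rightarrow> (nat \<Rightarrow> 'a) \<Rightarrow> 'a" where
  "pfister_value bs f = (\<Sum>i<2 ^ length bs. pfister_products bs ! i * (f i)\<^sup>2)"

lemma bform_pfister_diag:
  assumes "v \<in> carrier_vec (2 ^ length bs)" "w \<in> carrier_vec (2 ^ length bs)"
  shows "bform (pfister_diag bs) v w = (\<Sum>i<2 ^ length bs. pfister_products bs ! i * v $ i * w $ i)"
  using assms bform_diag_form[of v "pfister_products bs" w] by (simp add: pfister_diag_eq_diag_form)

lemma bform_pfister_diag_self:
  "v \<in> carrier_vec (2 ^ length bs) \<Longrightarrow> bform (pfister_diag bs) v v = pfister_value bs (($) v)"
  by (simp add: bform_pfister_diag pfister_value_def power2_eq_square mult.assoc)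

text \<open>
  The empty product heads the diagonal, so the orthogonal complement of the first basis vector is
  spanned by the other basis vectors, whose values are the nonempty products.
\<close>

lemma bform_pfister_diag_first:
  assumes "v \<in> carrier_vec (2 ^ length bs)"
  shows "bform (pfister_diag bs) (unit_vec (2 ^ length bs) 0) v = v $ 0"
proof -
  have "bform (pfister_diag bs) (unit_vec (2 ^ length bs) 0) v =
      (\<Sum>i<(2 :: nat) ^ length bs. if i = 0 then v $ 0 else 0)"
    unfolding bform_pfister_diag[OF unit_vec_carrier assms]
    by (rule sum.cong) (auto simp: pfister_products_nth_0)
  then show ?thesis by simp
qed

lemma pfister_value_Nil: "pfister_value [] f = (f 0)\<^sup>2"
  by (simp add: pfister_value_def)

text \<open>
  The isometry between \<open>\<langle>\<langle>b\<rangle>\<rangle> \<otimes> \<pi>\<close> and the orthogonal sum of \<open>\<pi>\<close> and \<open>b\<pi>\<close>, at the level of values;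
  it makes the values follow the recursions of the spans.
\<close>

lemma pfister_value_Cons:
  "pfister_value (b # bs) f = pfister_value bs f + b * pfister_value bs (\<lambda>i. f (2 ^ length bs + i))"
proof -
  let ?l = "2 ^ length bs :: nat"
  let ?g = "\<lambda>i. pfister_products (b # bs) ! i * (f i)\<^sup>2"
  have "pfister_value (b # bs) f = sum ?g {0..<?l} + sum ?g {?l..<?l + ?l}"
    by (simp add: pfister_value_def sum.atLeastLessThan_concat lessThan_atLeast0 mult_2)
  also have "sum ?g {0..<?l} = pfister_value bs f"
    by (simp add: pfister_value_def nth_append lessThan_atLeast0)
  also have "sum ?g {?l..<?l + ?l} = (\<Sum>i<?l. ?g (?l + i))"
    using sum.shift_bounds_nat_ivl[of ?g 0 ?l ?l] by (simp add: lessThan_atLeast0 add.commute)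
  also have "\<dots> = b * pfister_value bs (\<lambda>i. f (?l + i))"
    by (simp add: pfister_value_def nth_append sum_distrib_left mult.assoc)
  finally show ?thesis .
qed

lemma pfister_value_in_sqspan: "pfister_value bs f \<in> sqspan bs"
  by (induction bs arbitrary: f) (auto simp: pfister_value_Nil pfister_value_Cons squares_def)

lemma pfister_value_in_pure_span: "f 0 = 0 \<Longrightarrow> pfister_value bs f \<in> pure_span bs"
  by (induction bs) (auto simp: pfister_value_Nil pfister_value_Cons intro: pfister_value_in_sqspan)

context
  assumes char2: "CHAR('a :: field) = 2"
begin

text \<open>
  Linear independence of the products of subfamilies over the squares.
\<close>

lemma pfister_value_eq_0:
  assumes "two_independent bs" "pfister_value bs (f :: nat \<Rightarrow> 'a) = 0" "i < 2 ^ length bs"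
  shows "f i = 0"
  using assms
proof (induction bs arbitrary: f i)
  case (Cons b bs)
  let ?l = "2 ^ length bs :: nat"
  have "pfister_value bs f = 0 \<and> pfister_value bs (\<lambda>i. f (?l + i)) = 0"
    using Cons.prems(1,2)
    by (intro sqspan_Cons_unique[OF char2, of b bs] pfister_value_in_sqspan zero_in_sqspan)
      (simp_all add: pfister_value_Cons)
  then have "i < ?l \<Longrightarrow> f i = 0" "i - ?l < ?l \<Longrightarrow> f (?l + (i - ?l)) = 0"
    using Cons.IH[of f i] Cons.IH[of "\<lambda>i. f (?l + i)" "i - ?l"] Cons.prems(1) by auto
  then show ?case using Cons.prems(3) by (cases "i < ?l") auto
qed (simp add: pfister_value_Nil)

lemma pfister_value_add:
  "pfister_value bs (\<lambda>i. f i + g i) = pfister_value bs f + pfister_value bs (g :: nat \<Rightarrow> 'a)"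
  by (simp add: pfister_value_def square_add[OF char2] distrib_left sum.distrib)

lemma pfister_value_inject:
  assumes "two_independent bs" "pfister_value bs f = pfister_value bs (g :: nat \<Rightarrow> 'a)" "i < 2 ^ length bs"
  shows "f i = g i"
proof -
  have "pfister_value bs (\<lambda>i. f i + g i) = 0"
    by (simp add: pfister_value_add assms(2) add_self[OF char2])
  then have "f i + g i = 0"
    using pfister_value_eq_0 assms(1,3) by blast
  then show ?thesis
    by (metis diff_eq_add[OF char2] eq_iff_diff_eq_0)
qed

lemma anisotropic_pfister_diag:
  assumes "two_independent (bs :: 'a list)"
  shows "anisotropic (pfister_diag bs)"
  unfolding anisotropic_def dim_pfister_diag
proof (intro ballI impI notI)
  fix v :: "'a vec"
  assume v: "v \<in> carrier_vec (2 ^ length bs)" "v \<noteq> 0\<^sub>v (2 ^ length bs)"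
    "bform (pfister_diag bs) v v = 0"
  then have "v $ i = 0" if "i < 2 ^ length bs" for i
    using pfister_value_eq_0[OF assms _ that] bform_pfister_diag_self[OF v(1)] by simp
  then have "v = 0\<^sub>v (2 ^ length bs)"
    using v(1) by auto
  then show False using v(2) by simp
qed

section \<open>Slots and orthogonal pairs\<close>

text \<open>
  Values are injective, so \<open>e\<close> is the first basis vector, and orthogonality to it removes the
  coefficient of the empty product from \<open>\<beta>\<close>.
\<close>

lemma slot_in_pure_span:
  assumes indep: "two_independent (bs :: 'a list)"
    and e: "e \<in> carrier_vec (2 ^ length bs)" "bform (pfister_diag bs) e e = 1"
    and f: "f \<in> carrier_vec (2 ^ length bs)" "bform (pfister_diag bs) f f = \<beta>"
    and orth: "bform (pfister_diag bs) e f = 0"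
  shows "\<beta> \<in> pure_span bs"
proof -
  let ?u = "unit_vec (2 ^ length bs) 0 :: 'a vec"
  have "pfister_value bs (($) e) = pfister_value bs (($) ?u)"
    using e bform_pfister_diag_self[of ?u bs] bform_pfister_diag_first[of ?u bs]
    by (simp add: bform_pfister_diag_self)
  then have "e $ i = ?u $ i" if "i < 2 ^ length bs" for i
    using pfister_value_inject[OF indep] that by blast
  then have "e = ?u"
    using e(1) by (intro eq_vecI) auto
  then have "f $ 0 = 0"
    using orth bform_pfister_diag_first[OF f(1)] by simp
  then show ?thesis
    using pfister_value_in_pure_span f bform_pfister_diag_self[OF f(1)] by metis
qed

end

lemma isometric_preimage:
  assumes "M \<simeq>\<^sub>b N" "x \<in> carrier_vec (dim_row N)" "y \<in> carrier_vec (dim_row N)"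
  obtains x' y' where "x' \<in> carrier_vec (dim_row M)" "y' \<in> carrier_vec (dim_row M)"
    "bform M x' x' = bform N x x" "bform M x' y' = bform N x y" "bform M y' y' = bform N y y"
proof -
  let ?k = "dim_row M"
  obtain P where P: "P \<in> carrier_mat ?k ?k" "invertible_mat P"
      and iso: "\<And>v w. v \<in> carrier_vec ?k \<Longrightarrow> w \<in> carrier_vec ?k \<Longrightarrow>
        bform N (P *\<^sub>v v) (P *\<^sub>v w) = bform M v w"
      and k: "dim_row N = ?k"
    using assms(1) unfolding isometric_def by metis
  obtain Q where Q: "inverts_mat P Q" "inverts_mat Q P"
    using P(2) unfolding invertible_mat_def by blast
  have Qc: "Q \<in> carrier_mat ?k ?k"
    using P(1) arg_cong[OF Q(1)[unfolded inverts_mat_def], of dim_col]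
      arg_cong[OF Q(2)[unfolded inverts_mat_def], of dim_col]
    by (intro carrier_matI) auto
  have PQ: "P *\<^sub>v (Q *\<^sub>v v) = v" if "v \<in> carrier_vec ?k" for v
    using that P(1) Q(1) Qc assoc_mult_mat_vec[of P ?k ?k Q ?k v]
    by (simp add: inverts_mat_def)
  show ?thesis
    by (rule that[of "Q *\<^sub>v x" "Q *\<^sub>v y"])
      (use assms(2,3) Qc k in \<open>auto simp: PQ iso[symmetric]\<close>)
qed

lemma pfister_represents_one:
  assumes "is_pfister m \<pi>"
  obtains u where "u \<in> carrier_vec (dim_row \<pi>)" "bform \<pi> u u = 1"
proof -
  obtain cs where iso: "\<pi> \<simeq>\<^sub>b pfister_diag cs"
    using assms by (auto simp: is_pfister_def)
  let ?e = "unit_vec (2 ^ length cs) 0 :: 'a vec"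
  obtain u where "u \<in> carrier_vec (dim_row \<pi>)" "bform \<pi> u u = bform (pfister_diag cs) ?e ?e"
    by (rule isometric_preimage[OF iso, of ?e ?e]) (auto simp: dim_pfister_diag)
  then show ?thesis
    by (intro that) (auto simp: bform_pfister_diag_first)
qed

text \<open>
  If \<open>u\<close> is a vector of \<open>\<pi>\<close> with value 1, then the pure tensors of \<open>u\<close> with the two basis vectors
  of \<open>\<langle>\<langle>\<beta>\<rangle>\<rangle>\<close> are orthogonal in \<open>\<langle>\<langle>\<beta>\<rangle>\<rangle> \<otimes> \<pi>\<close> and have the values 1 and \<open>\<beta>\<close>.
\<close>

lemma pfister_factor_imp_orthogonal_pair:
  fixes \<beta> :: "'a :: field"
  assumes "pfister_factor 1 (pfister_diag [\<beta>]) n B"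
  obtains e f where "e \<in> carrier_vec (dim_row B)" "f \<in> carrier_vec (dim_row B)"
    "bform B e e = 1" "bform B e f = 0" "bform B f f = \<beta>"
proof -
  let ?D = "pfister_diag [\<beta>]"
  obtain \<pi> where \<pi>: "is_pfister (n - 1) \<pi>" and iso: "B \<simeq>\<^sub>b ?D \<otimes>\<^sub>b \<pi>"
    using assms by (auto simp: pfister_factor_def)
  obtain u where u: "u \<in> carrier_vec (dim_row \<pi>)" "bform \<pi> u u = 1"
    using pfister_represents_one[OF \<pi>] .
  have \<pi>c: "\<pi> \<in> carrier_mat (dim_row \<pi>) (dim_row \<pi>)"
    using \<pi> by (auto simp: is_pfister_def isometric_def is_form_def)
  have D: "?D \<in> carrier_mat 2 2"
    using dim_pfister_diag[of "[\<beta>]"] by (intro carrier_matI) simp_all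
  let ?e = "unit_vec 2 0 :: 'a vec" and ?f = "unit_vec 2 1 :: 'a vec"
  have vals: "bform ?D ?e ?e = 1" "bform ?D ?e ?f = 0" "bform ?D ?f ?f = \<beta>"
    by (simp_all only: pfister_diag_single) (simp_all add: bform_diag_form lessThan_nat_numeral lessThan_Suc numeral_2_eq_2)
  have T: "bform (?D \<otimes>\<^sub>b \<pi>) (tensor_vec x u) (tensor_vec y u) = bform ?D x y"
    if "x \<in> carrier_vec 2" "y \<in> carrier_vec 2" for x y
    using bform_tensor_form[OF D that \<pi>c u(1) u(1)] u(2) by simp
  have carrier: "tensor_vec x u \<in> carrier_vec (dim_row (?D \<otimes>\<^sub>b \<pi>))" if "x \<in> carrier_vec 2" for x
    using that u(1) dim_pfister_diag[of "[\<beta>]"] by (auto simp: tensor_vec_def tensor_form_def)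
  show ?thesis
    by (rule isometric_preimage[OF iso carrier[of ?e] carrier[of ?f]])
      (use that in \<open>simp_all del: pfister_diag.simps One_nat_def add: T vals\<close>)
qed

section \<open>Shifting the entries by 1\<close>

fun shifts :: "'a :: field list \<Rightarrow> 'a list set" where
  "shifts [] = {[]}"
| "shifts (a # as) = (#) a ` shifts as \<union> (#) (a + 1) ` shifts as"

lemma finite_shifts: "finite (shifts as)"
  by (induction as) auto

lemma card_shifts: "card (shifts as) = 2 ^ length as"
proof (induction as)
  case (Cons a as)
  have "card (shifts (a # as)) = card ((#) a ` shifts as) + card ((#) (a + 1) ` shifts as)"
    unfolding shifts.simps by (rule card_Un_disjoint) (auto simp: finite_shifts)
  then show ?case using Cons by (simp add: card_image)
qed simp

lemma length_shifts: "bs \<in> shifts as \<Longrightarrow> length bs = length as"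
  by (induction as arbitrary: bs) auto

lemma shifts_nonempty: "shifts as \<noteq> {}"
  by (induction as) auto

context
  assumes char2: "CHAR('a :: field) = 2"
begin

lemma sqspan_Cons_shift: "sqspan ((a :: 'a) # as) = sqspan ((a + 1) # as)"
proof -
  have sub: "sqspan (a # as) \<subseteq> sqspan ((a + 1) # as)" for a :: 'a
  proof
    fix z assume "z \<in> sqspan (a # as)"
    then obtain x y where xy: "z = x + a * y" "x \<in> sqspan as" "y \<in> sqspan as"
      by auto
    have "z = (x + y) + (a + 1) * y - (y + y)"
      by (simp add: xy(1) algebra_simps)
    then have "z = (x + y) + (a + 1) * y"
      by (simp only: add_self[OF char2]) simp
    then show "z \<in> sqspan ((a + 1) # as)"
      using sqspan_ConsI sqspan_add[OF char2] xy(2,3) by blast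
  qed
  have "a + 1 + 1 = a"
    by (simp only: add.assoc add_self[OF char2] add_0_right)
  then show ?thesis using sub[of a] sub[of "a + 1"] by auto
qed

lemma sqspan_shifts: "bs \<in> shifts as \<Longrightarrow> sqspan bs = sqspan (as :: 'a list)"
proof (induction as arbitrary: bs)
  case (Cons a as)
  then obtain b cs where bs: "bs = b # cs" "cs \<in> shifts as" "b = a \<or> b = a + 1" by auto
  then have "sqspan bs = sqspan (b # as)"
    using Cons.IH[OF bs(2)] by simp
  then show ?case using bs(3) sqspan_Cons_shift by metis
qed simp

lemma add_one_in_sqspan_iff: "(a :: 'a) + 1 \<in> sqspan as \<longleftrightarrow> a \<in> sqspan as"
proof -
  have "a + 1 + 1 = a"
    by (simp only: add.assoc add_self[OF char2] add_0_right)
  then show ?thesis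
    using sqspan_add[OF char2] one_in_sqspan by metis
qed

lemma two_independent_shifts:
  "bs \<in> shifts as \<Longrightarrow> two_independent as \<Longrightarrow> two_independent (bs :: 'a list)"
  by (induction as arbitrary: bs) (auto simp: sqspan_shifts add_one_in_sqspan_iff)

text \<open>
  Write \<open>x = u + a v = u' + (a + 1) v'\<close> with \<open>u, v, u', v'\<close> in the field generated by the tail.
  These coefficients are unique, hence do not depend on the shifts chosen for the tail. So \<open>u\<close>
  and \<open>u'\<close> lie in the pure spans of all shifts of the tail, and both vanish by induction. Comparing
  coefficients of 1 and \<open>a\<close> gives \<open>v = v'\<close> and \<open>u = u' + v'\<close>, so \<open>v = 0\<close> as well.
\<close>

lemma Inter_pure_span_shifts:
  assumes "two_independent (as :: 'a list)" "\<And>bs. bs \<in> shifts as \<Longrightarrow> x \<in> pure_span bs"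
  shows "x = 0"
  using assms
proof (induction as arbitrary: x)
  case (Cons a as)
  obtain cs where cs: "cs \<in> shifts as" using shifts_nonempty by blast
  have indep: "a \<notin> sqspan as" "a + 1 \<notin> sqspan as"
    using Cons.prems(1) add_one_in_sqspan_iff by auto
  have ex: "\<exists>u v. x = u + b * v \<and> u \<in> pure_span bs \<and> u \<in> sqspan as \<and> v \<in> sqspan as"
    if "bs \<in> shifts as" "b \<in> {a, a + 1}" for b bs
    using Cons.prems(2)[of "b # bs"] that sqspan_shifts[OF that(1)] pure_span_subset[of bs]
    by auto
  obtain u v where uv: "x = u + a * v" "u \<in> sqspan as" "v \<in> sqspan as"
    using ex[OF cs, of a] by auto
  obtain u' v' where uv': "x = u' + (a + 1) * v'" "u' \<in> sqspan as" "v' \<in> sqspan as"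
    using ex[OF cs, of "a + 1"] by auto
  have "u \<in> pure_span bs" if "bs \<in> shifts as" for bs
    using ex[OF that, of a] uv sqspan_Cons_unique[OF char2 indep(1)] by (metis insertCI)
  then have u: "u = 0" using Cons by auto
  have "u' \<in> pure_span bs" if "bs \<in> shifts as" for bs
    using ex[OF that, of "a + 1"] uv' sqspan_Cons_unique[OF char2 indep(2)] by (metis insertCI)
  then have u': "u' = 0" using Cons by auto
  have "u + a * v = (u' + v') + a * v'"
    using uv(1) uv'(1) by (simp add: algebra_simps)
  then have "u = u' + v' \<and> v = v'"
    using uv uv' by (intro sqspan_Cons_unique[OF char2 indep(1)] sqspan_add[OF char2]) auto
  then show ?case using uv(1) u u' by simp
qed simp

end

theorem theorem3p3:
  fixes n :: nat
  assumes "n \<ge> 2"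
    and "CHAR('a :: field) = 2"
    and "rank2 TYPE('a) = ereal (real n)"
  shows "\<exists>S :: 'a mat set. card S = 2 ^ n \<and>
           (\<forall>B \<in> S. is_pfister n B \<and> anisotropic B) \<and>
           \<not> (\<exists>\<beta>. common_slot \<beta> n S)"
proof -
  note char2 = assms(2)
  obtain as :: "'a list" where as: "length as = n" "two_independent as"
    using rank2_imp_two_independent[OF char2 assms(3)] assms(1) by auto
  have shifts: "two_independent bs" "length bs = n" if "bs \<in> shifts as" for bs
    using that as two_independent_shifts[OF char2] length_shifts by auto
  let ?S = "pfister_diag ` shifts as"
  show ?thesis
  proof (intro exI[of _ ?S] conjI ballI notI)
    have "inj_on pfister_diag (shifts as)"
      by (auto intro: inj_onI pfister_diag_inject)
    then show "card ?S = 2 ^ n"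
      by (simp add: card_image card_shifts as(1))
  next
    fix B assume "B \<in> ?S"
    then obtain bs where bs: "bs \<in> shifts as" and B: "B = pfister_diag bs" by auto
    show "is_pfister n B"
      using is_pfister_pfister_diag two_independent_nonzero shifts[OF bs] B by metis
    show "anisotropic B"
      using anisotropic_pfister_diag[OF char2] shifts(1)[OF bs] B by metis
  next
    assume "\<exists>\<beta>. common_slot \<beta> n ?S"
    then obtain \<beta> where "\<beta> \<noteq> 0"
        and factor: "\<And>bs. bs \<in> shifts as \<Longrightarrow> pfister_factor 1 (pfister_diag [\<beta>]) n (pfister_diag bs)"
      by (auto simp: common_slot_def)
    have "\<beta> \<in> pure_span bs" if bs: "bs \<in> shifts as" for bs
    proof -
      obtain e f where "e \<in> carrier_vec (2 ^ length bs)" "f \<in> carrier_vec (2 ^ length bs)"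
        "bform (pfister_diag bs) e e = 1" "bform (pfister_diag bs) e f = 0" "bform (pfister_diag bs) f f = \<beta>"
        using pfister_factor_imp_orthogonal_pair[OF factor[OF bs]] by (metis dim_pfister_diag(1))
      then show ?thesis
        using slot_in_pure_span[OF char2 shifts(1)[OF bs]] by blast
    qed
    then have "\<beta> = 0"
      using Inter_pure_span_shifts[OF char2 as(2)] by blast
    then show False using \<open>\<beta> \<noteq> 0\<close> by simp
  qed
qed

end
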